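(* Let $n\ge 3$ and $1\le k\le n$. A position $\mathbf p=(p_1,\dots,p_n)$ of $SN(n,k)$, with $p_n=\max_i p_i$, is reduced if and only if $p_n\le \Sigma(\mathbf p)/k$.
   Context: For an integer $n\ge 1$ and a nonempty set $A\subseteq\{1,\dots,n\}$, the game $SN(n,A)$ is played on $n$ stacks of tokens; a position is $\mathbf p=(p_1,\dots,p_n)$ of nonnegative integers, in non-decreasing order so $p_n=\max_i p_i$. A move consists of choosing some $\ell\in A$ and $\ell$ distinct stacks, each of height at least $1$, and removing exactly one token from each. $SN(n,k)$ denotes $SN(n,\{k\})$, and $\Sigma(\mathbf p)=\sum_i p_i$. A terminal position is one with no legal move. For a position $\mathbf p$, let $\mathcal T(\mathbf p)$ be the set of terminal positions reachable from $\mathbf p$ by finite sequences of legal moves, $u_i(\mathbf p)=\min\{t_i:\mathbf t\in\mathcal T(\mathbf p)\}$, and $r(\mathbf p)=\mathbf p-u(\mathbf p)$. The position $\mathbf p$ is reduced if $r(\mathbf p)=\mathbf p$. *)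

theory Defs
  imports Complex_Main
begin

text \<open>
  A configuration of \<open>n\<close> stacks is a list of length \<open>n\<close>; stack number \<open>i\<close>
  (\<open>1 \<le> i \<le> n\<close>) is entry \<open>i - 1\<close>.  Positions are listed in non-decreasing order, but the stacks keep
  their labels during play: a move does not re-sort the list, so that the coordinate \<open>t\<^sub>i\<close> of a
  reachable terminal configuration is the final height of the stack that started with height
  \<open>p\<^sub>i\<close>.
\<close>

definition sn_position :: "nat \<Rightarrow> nat list \<Rightarrow> bool" where
  "sn_position n p \<longleftrightarrow> length p = n \<and> sorted p"

definition sn_move :: "nat \<Rightarrow> nat set \<Rightarrow> nat list \<Rightarrow> nat list \<Rightarrow> bool" where
  "sn_move n A p q \<longleftrightarrow> length p = n \<and>
     (\<exists>S. S \<subseteq> {..<n} \<and> card S \<in> A \<and> (\<forall>i\<in>S. p ! i \<ge> 1) \<and>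
          q = map (\<lambda>i. if i \<in> S then p ! i - 1 else p ! i) [0..<n])"

definition sn_terminal :: "nat \<Rightarrow> nat set \<Rightarrow> nat list \<Rightarrow> bool" where
  "sn_terminal n A p \<longleftrightarrow> (\<nexists>q. sn_move n A p q)"

definition sn_terminals :: "nat \<Rightarrow> nat set \<Rightarrow> nat list \<Rightarrow> nat list set" where
  "sn_terminals n A p = {t. (sn_move n A)\<^sup>*\<^sup>* p t \<and> sn_terminal n A t}"

text \<open>
  If \<open>0 \<notin> A\<close>, the infimum is a minimum and the subtraction below does not truncate: see
  \<open>sn_terminals_nonempty\<close> and \<open>sn_u_le\<close>.
\<close>

definition sn_u :: "nat \<Rightarrow> nat set \<Rightarrow> nat list \<Rightarrow> nat list" where
  "sn_u n A p = map (\<lambda>i. Inf {t ! i | t. t \<in> sn_terminals n A p}) [0..<n]"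

definition sn_r :: "nat \<Rightarrow> nat set \<Rightarrow> nat list \<Rightarrow> nat list" where
  "sn_r n A p = map (\<lambda>i. p ! i - sn_u n A p ! i) [0..<n]"

definition sn_reduced :: "nat \<Rightarrow> nat set \<Rightarrow> nat list \<Rightarrow> bool" where
  "sn_reduced n A p \<longleftrightarrow> sn_r n A p = p"

lemma sn_move_sum_less:
  assumes "sn_move n A p q" "0 \<notin> A"
  shows "sum_list q < sum_list p"
proof -
  from assms(1) obtain S where S: "length p = n" "S \<subseteq> {..<n}" "card S \<in> A" "\<forall>i\<in>S. p ! i \<ge> 1"
    and q: "q = map (\<lambda>i. if i \<in> S then p ! i - 1 else p ! i) [0..<n]"
    unfolding sn_move_def by blast
  from S(3) assms(2) have "S \<noteq> {}" by auto
  then obtain j where j: "j \<in> S" by blast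
  have "sum_list q = (\<Sum>i<n. if i \<in> S then p ! i - 1 else p ! i)"
    unfolding q by (simp add: interv_sum_list_conv_sum_set_nat atLeast0LessThan)
  also have "\<dots> < (\<Sum>i<n. p ! i)"
  proof (rule sum_strict_mono_ex1)
    show "\<exists>a\<in>{..<n}. (if a \<in> S then p ! a - 1 else p ! a) < p ! a"
      using j S by (intro bexI[of _ j]) (auto dest!: bspec[of _ _ j])
  qed auto
  also have "\<dots> = sum_list p"
    using S(1) by (simp add: sum_list_sum_nth atLeast0LessThan)
  finally show ?thesis .
qed

lemma sn_terminals_nonempty:
  assumes "0 \<notin> A"
  shows "sn_terminals n A p \<noteq> {}"
proof (induction p rule: measure_induct_rule[of sum_list])
  case (less p)
  show ?case
  proof (cases "sn_terminal n A p")
    case True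
    then show ?thesis by (auto simp: sn_terminals_def)
  next
    case False
    then obtain q where q: "sn_move n A p q" by (auto simp: sn_terminal_def)
    from less[OF sn_move_sum_less[OF q assms]] obtain t where "t \<in> sn_terminals n A q" by blast
    with q show ?thesis
      by (auto simp: sn_terminals_def intro: converse_rtranclp_into_rtranclp)
  qed
qed

lemma sn_reachable_le:
  assumes "(sn_move n A)\<^sup>*\<^sup>* p t" "length p = n" "i < n"
  shows "t ! i \<le> p ! i"
  using assms(1)
proof induction
  case (step q t)
  from step(2) have "t ! i \<le> q ! i" using assms(3) by (auto simp: sn_move_def)
  with step.IH show ?case by simp
qed simp

lemma sn_u_le:
  assumes "0 \<notin> A" "length p = n" "i < n"
  shows "sn_u n A p ! i \<le> p ! i"
proof -
  from sn_terminals_nonempty[OF assms(1), of n p] obtain t where t: "t \<in> sn_terminals n A p" by blast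
  then have "sn_u n A p ! i \<le> t ! i"
    using assms(3) unfolding sn_u_def by (auto intro!: cInf_lower)
  also have "\<dots> \<le> p ! i"
    using t assms(2,3) by (auto simp: sn_terminals_def intro: sn_reachable_le)
  finally show ?thesis .
qed

end

theory Submission
  imports Defs
begin

text \<open>
  Emptying stack \<open>n\<close> takes \<open>p\<^sub>n\<close> moves of \<open>k\<close> tokens each, so \<open>k p\<^sub>n \<le> \<Sigma>(p)\<close> whenever \<open>p\<close> is
  reduced.  Conversely, let \<open>M = \<Sigma>(p) div k\<close>, so that all stacks have height at most \<open>M\<close>.  Given a
  stack \<open>i\<close>, set aside \<open>\<Sigma>(p) mod k\<close> tokens from the other stacks.  The remaining tokens
  \<open>q\<^sub>j \<le> M\<close> total \<open>k M\<close> and can be removed in \<open>M\<close> moves by always playing on all stacks with \<open>q\<^sub>j\<close>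
  equal to the number of moves left.  Fewer than \<open>k\<close> tokens remain, and none of them on stack \<open>i\<close>.
\<close>

text \<open>Greedy filling: each new index takes as much of \<open>r\<close> as \<open>f\<close>
  allows and leaves the rest to the other indices. This selects the tokens to be set aside.\<close>

lemma exists_fun_le_sum_eq:
  fixes f :: "'a \<Rightarrow> nat"
  assumes "finite A" and "r \<le> sum f A"
  shows "\<exists>g. (\<forall>j. g j \<le> f j) \<and> (\<forall>j. j \<notin> A \<longrightarrow> g j = 0) \<and> sum g A = r"
  using assms
proof (induction A arbitrary: r rule: finite_induct)
  case empty
  then show ?case by (intro exI[of _ "\<lambda>_. 0"]) auto
next
  case (insert x A)
  have "r - min r (f x) \<le> sum f A"
    using insert.prems insert.hyps by simp
  from insert.IH[OF this] obtain g where
    g: "\<forall>j. g j \<le> f j" "\<forall>j. j \<notin> A \<longrightarrow> g j = 0" "sum g A = r - min r (f x)" by blast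
  have "sum (g(x := min r (f x))) A = sum g A"
    using insert.hyps by (intro sum.cong) auto
  with g insert.hyps show ?case
    by (intro exI[of _ "g(x := min r (f x))"]) auto
qed

text \<open>More than \<open>k\<close> indices with value \<open>M\<close> would push the sum above
  \<open>k * M\<close>, and fewer than \<open>k\<close> positive ones could not reach it. Some
  \<open>S\<close> of size \<open>k\<close> therefore lies between these two sets; it is the next
  move when \<open>M\<close> moves remain.\<close>

lemma exists_balanced_subset:
  fixes q :: "'a \<Rightarrow> nat"
  assumes "finite A" and sum: "sum q A = k * M" and "M > 0" and le: "\<And>j. j \<in> A \<Longrightarrow> q j \<le> M"
  obtains S where "S \<subseteq> A" "card S = k" "\<And>j. j \<in> S \<Longrightarrow> q j \<ge> 1" "\<And>j. j \<in> A - S \<Longrightarrow> q j < M"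
proof -
  let ?F = "{j \<in> A. q j = M}" and ?P = "{j \<in> A. q j \<ge> 1}"
  have "card ?F * M = sum q ?F" by simp
  also have "\<dots> \<le> sum q A" using \<open>finite A\<close> by (intro sum_mono2) auto
  finally have F: "card ?F \<le> k" using sum \<open>M > 0\<close> by simp
  have "k * M = sum q ?P"
    unfolding sum[symmetric] using \<open>finite A\<close> by (intro sum.mono_neutral_right) auto
  also have "\<dots> \<le> card ?P * M" using le sum_bounded_above[of ?P q M] by simp
  finally have P: "k \<le> card ?P" using \<open>M > 0\<close> by simp
  \<comment> \<open>\<open>M > 0\<close> gives the inclusion of \<open>?F\<close> in
    \<open>?P\<close>.\<close>
  obtain S where "?F \<subseteq> S" "S \<subseteq> ?P" "card S = k"
    using exists_subset_between[OF F P] \<open>finite A\<close> \<open>M > 0\<close> by fastforce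
  with le show thesis
    by (intro that[of S]) (fastforce simp: order.strict_iff_order)+
qed

text \<open>Here \<open>q j\<close> counts the tokens still to be taken from stack \<open>j\<close>
  in \<open>M\<close> moves. Playing on a balanced subset keeps the hypotheses true with one move
  fewer, since every stack whose quota equals the number of moves left is played.\<close>

lemma sn_reachable_diff:
  assumes "length p = n" and "\<And>j. j < n \<Longrightarrow> q j \<le> p ! j" and "\<And>j. j < n \<Longrightarrow> q j \<le> M"
    and "sum q {..<n} = k * M"
  shows "(sn_move n {k})\<^sup>*\<^sup>* p (map (\<lambda>j. p ! j - q j) [0..<n])"
  using assms
proof (induction M arbitrary: p q)
  case 0
  then have "map (\<lambda>j. p ! j - q j) [0..<n] = p"
    by (auto intro: nth_equalityI)
  then show ?case by simp
next
  case (Suc M)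
  obtain S where S: "S \<subseteq> {..<n}" "card S = k" "\<And>j. j \<in> S \<Longrightarrow> q j \<ge> 1"
    "\<And>j. j \<in> {..<n} - S \<Longrightarrow> q j < Suc M"
    using exists_balanced_subset[of "{..<n}" q k "Suc M"] Suc.prems by auto
  define p' where "p' = map (\<lambda>j. if j \<in> S then p ! j - 1 else p ! j) [0..<n]"
  define q' where "q' j = (if j \<in> S then q j - 1 else q j)" for j
  have "\<forall>j\<in>S. p ! j \<ge> 1"
    using S(1,3) Suc.prems(2) by (meson lessThan_iff order_trans subset_iff)
  then have move: "sn_move n {k} p p'"
    using S(1,2) Suc.prems(1) unfolding sn_move_def p'_def by blast
  have "sum q {..<n} = (\<Sum>j<n. q' j + (if j \<in> S then 1 else 0))"
    using S(3) by (intro sum.cong) (auto simp: q'_def Suc_le_eq)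
  also have "\<dots> = sum q' {..<n} + k"
    using S(1,2) by (simp add: sum.distrib sum.If_cases Int_absorb1)
  finally have "sum q' {..<n} = k * M" using Suc.prems(4) by simp
  moreover have "q' j \<le> p' ! j" if "j < n" for j
    using that Suc.prems(2)[of j] by (auto simp: q'_def p'_def)
  moreover have "q' j \<le> M" if "j < n" for j
    using that Suc.prems(3)[of j] S(4)[of j] by (auto simp: q'_def)
  ultimately have "(sn_move n {k})\<^sup>*\<^sup>* p' (map (\<lambda>j. p' ! j - q' j) [0..<n])"
    by (intro Suc.IH) (auto simp: p'_def)
  moreover have "map (\<lambda>j. p' ! j - q' j) [0..<n] = map (\<lambda>j. p ! j - q j) [0..<n]"
    using S(3) by (auto simp: p'_def q'_def)
  ultimately show ?case
    using move by (simp add: converse_rtranclp_into_rtranclp)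
qed

lemma sn_terminal_if_sum_less:
  assumes "sum_list t < k"
  shows "sn_terminal n {k} t"
  unfolding sn_terminal_def
proof
  assume "\<exists>q. sn_move n {k} t q"
  then obtain S where S: "length t = n" "S \<subseteq> {..<n}" "card S = k" "\<forall>i\<in>S. t ! i \<ge> 1"
    unfolding sn_move_def by auto
  have "k \<le> (\<Sum>i\<in>S. t ! i)" using S(3,4) sum_bounded_below[of S 1 "(!) t"] by simp
  also have "\<dots> \<le> (\<Sum>i<n. t ! i)" using S(2) by (intro sum_mono2) auto
  also have "\<dots> = sum_list t" using S(1) by (simp add: sum_list_sum_nth atLeast0LessThan)
  finally show False using assms by simp
qed

lemma sn_terminal_emptying_stack:
  assumes len: "length p = n" and "1 \<le> k" and "i < n"
    and le: "\<And>j. j < n \<Longrightarrow> k * p ! j \<le> sum_list p"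
  shows "\<exists>t \<in> sn_terminals n {k} p. t ! i = 0"
proof -
  define M where "M = sum_list p div k"
  define r where "r = sum_list p mod k"
  have sum_p: "sum_list p = (\<Sum>j<n. p ! j)"
    using len by (simp add: sum_list_sum_nth atLeast0LessThan)
  have Mr: "sum_list p = k * M + r" unfolding M_def r_def by simp
  have pM: "p ! j \<le> M" if "j < n" for j
    using le[OF that] \<open>1 \<le> k\<close> unfolding M_def by (simp add: less_eq_div_iff_mult_less_eq mult.commute)
  \<comment> \<open>Stack \<open>i\<close> holds at most \<open>M \<le> k * M\<close> tokens, so the
    other stacks hold at least the remainder \<open>r\<close>.\<close>
  have "M \<le> k * M" using \<open>1 \<le> k\<close> by simp
  moreover have "(\<Sum>j<n. p ! j) = p ! i + (\<Sum>j\<in>{..<n} - {i}. p ! j)"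
    using \<open>i < n\<close> by (intro sum.remove) auto
  ultimately have "r \<le> (\<Sum>j\<in>{..<n} - {i}. p ! j)"
    using pM[OF \<open>i < n\<close>] Mr sum_p by linarith
  then obtain g where g: "\<forall>j. g j \<le> p ! j" "\<forall>j. j \<notin> {..<n} - {i} \<longrightarrow> g j = 0"
    "sum g ({..<n} - {i}) = r"
    using exists_fun_le_sum_eq[of "{..<n} - {i}" r "(!) p"] by blast
  have sum_g: "sum g {..<n} = r"
    using g(2,3) \<open>i < n\<close> by (simp add: sum.remove[of "{..<n}" i])
  \<comment> \<open>The quota to remove is \<open>p ! j - g j\<close>, so exactly \<open>g j\<close>
    tokens stay on stack \<open>j\<close>.\<close>
  define t where "t = map (\<lambda>j. p ! j - (p ! j - g j)) [0..<n]"
  have "(\<Sum>j<n. p ! j - g j) = k * M"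
    using g(1) Mr sum_p sum_g by (simp add: sum_subtractf_nat)
  then have "(sn_move n {k})\<^sup>*\<^sup>* p t"
    unfolding t_def using len pM by (intro sn_reachable_diff[where M = M]) (auto intro: le_trans[OF diff_le_self])
  moreover have "t = map g [0..<n]" using g(1) unfolding t_def by simp
  then have "sum_list t = r" "t ! i = 0"
    using sum_g g(2) \<open>i < n\<close> by (auto simp: interv_sum_list_conv_sum_set_nat atLeast0LessThan)
  moreover have "r < k" using \<open>1 \<le> k\<close> unfolding r_def by simp
  ultimately show ?thesis
    unfolding sn_terminals_def using sn_terminal_if_sum_less[of t k n] by auto
qed

text \<open>A move lowers the total by exactly \<open>k\<close> and stack \<open>i\<close> by at
  most 1, so \<open>k\<close> times the height of stack \<open>i\<close> minus the total never
  decreases. The additive form avoids truncated subtraction.\<close>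

lemma sn_reachable_sum_bound:
  assumes "(sn_move n {k})\<^sup>*\<^sup>* p t" and "length p = n" and "i < n"
  shows "length t = n \<and> k * p ! i + sum_list t \<le> k * t ! i + sum_list p"
  using assms(1)
proof induction
  case base
  then show ?case using assms(2) by simp
next
  case (step q t)
  from step(2) obtain S where S: "length q = n" "S \<subseteq> {..<n}" "card S = k" "\<forall>i\<in>S. q ! i \<ge> 1"
    and t: "t = map (\<lambda>i. if i \<in> S then q ! i - 1 else q ! i) [0..<n]"
    unfolding sn_move_def by auto
  have "sum_list q = (\<Sum>j<n. t ! j + (if j \<in> S then 1 else 0))"
    using S(1,4) by (auto simp: sum_list_sum_nth atLeast0LessThan t Suc_le_eq intro!: sum.cong)
  also have "\<dots> = sum_list t + k"
    using S(2,3) by (simp add: sum.distrib sum.If_cases Int_absorb1 sum_list_sum_nth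
        atLeast0LessThan t)
  finally have "sum_list q = sum_list t + k" .
  moreover have "q ! i \<le> t ! i + 1" using assms(3) by (simp add: t, linarith)
  then have "k * q ! i \<le> k * t ! i + k" by (metis mult_le_mono2 distrib_left mult_1_right)
  ultimately show ?case using step.IH t by simp
qed

text \<open>The infimum of a nonempty set of naturals is attained.\<close>

lemma sn_u_eq_0_iff:
  assumes "0 \<notin> A" and "i < n"
  shows "sn_u n A p ! i = 0 \<longleftrightarrow> (\<exists>t \<in> sn_terminals n A p. t ! i = 0)"
proof -
  let ?H = "{t ! i | t. t \<in> sn_terminals n A p}"
  have "Inf ?H \<in> ?H"
    using sn_terminals_nonempty[OF assms(1)] by (intro Inf_nat_def1) blast
  moreover have "Inf ?H \<le> 0" if "0 \<in> ?H"
    using that by (intro cInf_lower) auto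
  ultimately have "Inf ?H = 0 \<longleftrightarrow> 0 \<in> ?H" by (metis (lifting) le_0_eq)
  then show ?thesis
    using assms(2) by (auto simp: sn_u_def)
qed

lemma sn_reduced_iff:
  assumes "0 \<notin> A" and "length p = n"
  shows "sn_reduced n A p \<longleftrightarrow> (\<forall>i<n. \<exists>t \<in> sn_terminals n A p. t ! i = 0)"
proof -
  \<comment> \<open>For \<open>p ! i = 0\<close> the truncated difference is 0 whatever is
    subtracted; there the bound \<open>sn_u_le\<close> is what forces
    \<open>sn_u n A p ! i = 0\<close>.\<close>
  have "p ! i - sn_u n A p ! i = p ! i \<longleftrightarrow> sn_u n A p ! i = 0" if "i < n" for i
    using sn_u_le[OF assms that] by linarith
  then show ?thesis
    using assms by (simp add: sn_reduced_def sn_r_def list_eq_iff_nth_eq sn_u_eq_0_iff)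
qed

theorem theorem2:
  fixes n k :: nat and p :: "nat list"
  assumes "n \<ge> 3" and "1 \<le> k" and "k \<le> n"
    and "sn_position n p"
  shows "sn_reduced n {k} p \<longleftrightarrow> real (p ! (n - 1)) \<le> real (sum_list p) / real k"
proof -
  have len: "length p = n" and "sorted p" using assms(4) by (auto simp: sn_position_def)
  have "real (p ! (n - 1)) \<le> real (sum_list p) / real k \<longleftrightarrow>
      real (k * p ! (n - 1)) \<le> real (sum_list p)"
    using assms(2) by (simp add: field_simps)
  also have "\<dots> \<longleftrightarrow> k * p ! (n - 1) \<le> sum_list p" by (rule of_nat_le_iff)
  also have "\<dots> \<longleftrightarrow> sn_reduced n {k} p"
  proof
    assume le: "k * p ! (n - 1) \<le> sum_list p"
    have "k * p ! j \<le> sum_list p" if "j < n" for j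
    proof -
      have "p ! j \<le> p ! (n - 1)" using \<open>sorted p\<close> len that by (intro sorted_nth_mono) auto
      then show ?thesis using le by (meson le_trans mult_le_mono2)
    qed
    then show "sn_reduced n {k} p"
      using sn_terminal_emptying_stack[OF len] assms(2) len by (simp add: sn_reduced_iff)
  next
    assume "sn_reduced n {k} p"
    then have "\<exists>t \<in> sn_terminals n {k} p. t ! (n - 1) = 0"
      using assms(1,2) len by (simp add: sn_reduced_iff)
    then obtain t where "(sn_move n {k})\<^sup>*\<^sup>* p t" "t ! (n - 1) = 0"
      by (auto simp: sn_terminals_def)
    then show "k * p ! (n - 1) \<le> sum_list p"
      using sn_reachable_sum_bound[of n k p t "n - 1"] assms(1) len by simp
  qed
  finally show ?thesis by blast
qed

end
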